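(* Let $\sum_{n=0}^{\infty}u_n$ be a convergent series of fuzzy numbers. If $\sum_{n=0}^{\infty}x_n$ is a convergent series with non-negative real terms, then $$\left(\sum_{n=0}^{\infty}x_n\right)\left(\sum_{n=0}^{\infty}u_n\right)=\sum_{n=0}^{\infty}\sum_{k=0}^{n}u_kx_{n-k},$$ where the equality means that the series of fuzzy numbers on the right (with $n$-th term $\sum_{k=0}^n x_{n-k}u_k$) converges and its sum is the fuzzy number on the left.
   Context: A fuzzy number is a function $u:\mathbb{R}\to[0,1]$ that is normal ($u(t_0)=1$ for some $t_0$), fuzzy convex ($u(\lambda s+(1-\lambda)t)\ge\min\{u(s),u(t)\}$ for $s,t\in\mathbb{R}$, $\lambda\in[0,1]$), upper semicontinuous, and has compact support $\overline{\{t:u(t)>0\}}$. The set of fuzzy numbers is $E^1$. For $u\in E^1$ the $\alpha$-level set is $[u]_\alpha=\{t:u(t)\ge\alpha\}$ for $0<\alpha\le1$ and $[u]_0=\overline{\{t:u(t)>0\}}$; it is a compact interval, written $[u]_\alpha=[u^-_\alpha,u^+_\alpha]$. Addition and scalar multiplication ($k\in\mathbb{R}$) are defined by $[u+v]_\alpha=[u^-_\alpha+v^-_\alpha,\,u^+_\alpha+v^+_\alpha]$ and $[ku]_\alpha=k[u]_\alpha$ for all $\alpha\in[0,1]$; $uk$ also denotes $ku$. The metric on $E^1$ is $D(u,v)=\sup_{\alpha\in[0,1]}\max\{|u^-_\alpha-v^-_\alpha|,|u^+_\alpha-v^+_\alpha|\}$; convergence in $E^1$ means convergence with respect to $D$.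 A series $\sum_{n=0}^\infty u_n$ of fuzzy numbers converges to $u\in E^1$, written $\sum_{n=0}^\infty u_n=u$, if its partial sums $\sum_{k=0}^n u_k$ converge to $u$. *)

theory Defs
  imports "HOL-Analysis.Analysis"
begin

text \<open>The fourth conjunct is upper semicontinuity.\<close>

definition is_fuzzy_number :: "(real \<Rightarrow> real) \<Rightarrow> bool" where
  "is_fuzzy_number u \<longleftrightarrow>
     (\<forall>t. 0 \<le> u t \<and> u t \<le> 1) \<and>
     (\<exists>t. u t = 1) \<and>
     (\<forall>s t. \<forall>l\<in>{0..1}. u (l * s + (1 - l) * t) \<ge> min (u s) (u t)) \<and>
     (\<forall>t y. u t < y \<longrightarrow> (\<forall>\<^sub>F s in at t. u s < y)) \<and>
     compact (closure {t. u t > 0})"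

typedef fuzzy_number = "{u. is_fuzzy_number u}"
  morphisms membership Abs_fuzzy_number
proof
  let ?u = "\<lambda>t::real. if t = 0 then 1 else (0::real)"
  have s: "{t. ?u t > 0} = {0}" by auto
  have c: "\<forall>s t. \<forall>l\<in>{0..1}. ?u (l * s + (1 - l) * t) \<ge> min (?u s) (?u t)" by auto
  have usc: "\<forall>\<^sub>F s in at t. ?u s < y" if "?u t < y" for t y
  proof (cases "t = 0")
    case True
    with that show ?thesis by (auto intro!: always_eventually)
  next
    case False
    have "\<forall>\<^sub>F s in at t. s \<noteq> 0" by (rule eventually_neq_at_within)
    then show ?thesis by (rule eventually_mono) (use that False in auto)
  qed
  show "?u \<in> {u. is_fuzzy_number u}"
    unfolding is_fuzzy_number_def mem_Collect_eq s
    by (intro conjI c allI impI usc) auto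
qed

text \<open>Level sets and their end points are meaningful for parameters in the unit interval only.\<close>

definition level :: "fuzzy_number \<Rightarrow> real \<Rightarrow> real set" where
  "level u \<alpha> =
     (if \<alpha> = 0 then closure {t. membership u t > 0} else {t. membership u t \<ge> \<alpha>})"

definition lower :: "fuzzy_number \<Rightarrow> real \<Rightarrow> real" where
  "lower u \<alpha> = Inf (level u \<alpha>)"

definition upper :: "fuzzy_number \<Rightarrow> real \<Rightarrow> real" where
  "upper u \<alpha> = Sup (level u \<alpha>)"

lemma fn:
  shows fn_ge0: "0 \<le> membership u t" and fn_le1: "membership u t \<le> 1"
    and fn_normal: "\<exists>t. membership u t = 1"
    and fn_convex: "\<lbrakk>0 \<le> l; l \<le> 1\<rbrakk> \<Longrightarrow>
      min (membership u s) (membership u t) \<le> membership u (l * s + (1 - l) * t)"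
    and fn_usc: "membership u t < y \<Longrightarrow> \<forall>\<^sub>F s in at t. membership u s < y"
    and fn_compact: "compact (closure {t. membership u t > 0})"
  using membership[of u] by (auto simp: is_fuzzy_number_def)

lemma level_antimono:
  assumes "0 \<le> \<alpha>" "\<alpha> \<le> \<beta>"
  shows "level u \<beta> \<subseteq> level u \<alpha>"
proof (cases "\<alpha> = 0 \<and> \<beta> \<noteq> 0")
  case True
  then have "level u \<beta> \<subseteq> {t. membership u t > 0}"
    using assms by (auto simp: level_def)
  then show ?thesis
    using True closure_subset[of "{t. membership u t > 0}"] by (auto simp: level_def)
qed (use assms in \<open>auto simp: level_def\<close>)

lemma level_nonempty: "\<alpha> \<in> {0..1} \<Longrightarrow> level u \<alpha> \<noteq> {}"
proof -
  assume a: "\<alpha> \<in> {0..1}"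
  obtain t where "membership u t = 1" using fn_normal by blast
  then have "t \<in> level u 1" by (simp add: level_def)
  then show ?thesis using level_antimono[of \<alpha> 1 u] a by auto
qed

lemma convex_membership:
  shows "convex {t. membership u t \<ge> \<alpha>}" "convex {t. membership u t > 0}"
proof -
  have key: "min (membership u x) (membership u y) \<le> membership u (a * x + b * y)"
    if "0 \<le> a" "0 \<le> b" "a + b = 1" for x y a b
  proof -
    have b: "b = 1 - a" using that by simp
    have "a \<le> 1" using that by simp
    then show ?thesis unfolding b using fn_convex[of a u x y] that(1) by blast
  qed
  show "convex {t. membership u t \<ge> \<alpha>}"
  proof (rule convexI)
    fix x y a b assume "x \<in> {t. membership u t \<ge> \<alpha>}" "y \<in> {t. membership u t \<ge> \<alpha>}"
      "0 \<le> a" "0 \<le> b" "a + b = (1::real)"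
    then show "a *\<^sub>R x + b *\<^sub>R y \<in> {t. membership u t \<ge> \<alpha>}"
      using key[of a b x y] by simp
  qed
  show "convex {t. membership u t > 0}"
  proof (rule convexI)
    fix x y a b assume "x \<in> {t. membership u t > 0}" "y \<in> {t. membership u t > 0}"
      "0 \<le> a" "0 \<le> b" "a + b = (1::real)"
    then show "a *\<^sub>R x + b *\<^sub>R y \<in> {t. membership u t > 0}"
      using key[of a b x y] by simp
  qed
qed

lemma level_convex: "\<alpha> \<in> {0..1} \<Longrightarrow> convex (level u \<alpha>)"
  using convex_membership
  by (auto simp: level_def intro: convex_closure)

lemma level_compact:
  assumes "\<alpha> \<in> {0..1}"
  shows "compact (level u \<alpha>)"
proof (cases "\<alpha> = 0")
  case True
  then show ?thesis using fn_compact by (simp add: level_def)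
next
  case False
  have "open {t. membership u t < \<alpha>}"
  proof (subst open_subopen, rule ballI)
    fix t assume "t \<in> {t. membership u t < \<alpha>}"
    then have m: "membership u t < \<alpha>" by simp
    then have "\<forall>\<^sub>F s in nhds t. membership u s < \<alpha>"
      using fn_usc[OF m] by (auto simp: eventually_at_filter elim: eventually_mono)
    then show "\<exists>T. open T \<and> t \<in> T \<and> T \<subseteq> {t. membership u t < \<alpha>}"
      by (auto simp: eventually_nhds)
  qed
  moreover have "- level u \<alpha> = {t. membership u t < \<alpha>}"
    using False by (auto simp: level_def)
  ultimately have "closed (level u \<alpha>)" by (simp add: closed_def)
  moreover have "level u \<alpha> \<subseteq> level u 0" using level_antimono[of 0 \<alpha> u] assms by simp
  moreover have "compact (level u 0)" using fn_compact by (simp add: level_def)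
  ultimately show ?thesis by (metis compact_Int_closed inf.absorb2)
qed

lemma level_interval:
  assumes "\<alpha> \<in> {0..1}"
  shows "level u \<alpha> = {lower u \<alpha>..upper u \<alpha>}" "lower u \<alpha> \<le> upper u \<alpha>"
proof -
  have "connected (level u \<alpha>)" using level_convex[OF assms] convex_connected by blast
  then obtain a b where ab: "level u \<alpha> = {a..b}"
    using level_compact[OF assms] connected_compact_interval_1 by blast
  moreover have "a \<le> b" using level_nonempty[OF assms, of u] ab by auto
  ultimately show "level u \<alpha> = {lower u \<alpha>..upper u \<alpha>}" "lower u \<alpha> \<le> upper u \<alpha>"
    by (auto simp: lower_def upper_def)
qed

lemma level_left:
  assumes "\<alpha> \<in> {0<..1}" "\<And>\<beta>. 0 < \<beta> \<Longrightarrow> \<beta> < \<alpha> \<Longrightarrow> t \<in> level u \<beta>"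
  shows "t \<in> level u \<alpha>"
proof -
  have le: "\<beta> \<le> membership u t" if "0 < \<beta>" "\<beta> < \<alpha>" for \<beta>
    using assms(2)[OF that] that by (simp add: level_def)
  have "\<alpha> \<le> membership u t"
    by (rule dense_le_bounded[of 0]) (use assms(1) le in auto)
  then show ?thesis using assms(1) by (simp add: level_def)
qed

lemma level_0: "level u 0 = closure (\<Union>\<alpha>\<in>{0<..1}. level u \<alpha>)"
proof -
  have "{t. membership u t > 0} = (\<Union>\<alpha>\<in>{0<..1}. level u \<alpha>)"
    using fn_le1[of u] by (auto simp: level_def intro!: bexI[of _ "membership u _"])
  then show ?thesis by (simp add: level_def)
qed

lemma fuzzy_number_level_eqI:
  assumes "\<And>\<alpha>. \<alpha> \<in> {0..1} \<Longrightarrow> level u \<alpha> = level v \<alpha>"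
  shows "u = v"
proof -
  have "membership u t \<le> membership v t"
    if "\<And>\<alpha>. \<alpha> \<in> {0..1} \<Longrightarrow> level u \<alpha> = level v \<alpha>" for u v t
  proof (cases "membership u t = 0")
    case False
    then have "t \<in> level u (membership u t)" by (simp add: level_def)
    then have "t \<in> level v (membership u t)" using that fn_ge0 fn_le1 by auto
    then show ?thesis using False by (simp add: level_def)
  qed (simp add: fn_ge0)
  then have "membership u = membership v" using assms by (auto intro!: ext antisym)
  then show ?thesis by (simp add: membership_inject)
qed

lemma fuzzy_number_eqI:
  assumes "\<And>\<alpha>. \<alpha> \<in> {0..1} \<Longrightarrow> lower u \<alpha> = lower v \<alpha>"
    "\<And>\<alpha>. \<alpha> \<in> {0..1} \<Longrightarrow> upper u \<alpha> = upper v \<alpha>"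
  shows "u = v"
  using assms by (intro fuzzy_number_level_eqI) (simp add: level_interval)

text \<open>Representation theorem: the descriptions of sum and scalar multiple by level sets below
  are well defined because of it.\<close>

lemma fuzzy_number_of_levels:
  fixes I :: "real \<Rightarrow> real set"
  assumes comp: "\<And>\<alpha>. \<alpha> \<in> {0..1} \<Longrightarrow> compact (I \<alpha>)"
    and conv: "\<And>\<alpha>. \<alpha> \<in> {0..1} \<Longrightarrow> convex (I \<alpha>)"
    and ne: "\<And>\<alpha>. \<alpha> \<in> {0..1} \<Longrightarrow> I \<alpha> \<noteq> {}"
    and anti: "\<And>\<alpha> \<beta>. 0 \<le> \<alpha> \<Longrightarrow> \<alpha> \<le> \<beta> \<Longrightarrow> \<beta> \<le> 1 \<Longrightarrow> I \<beta> \<subseteq> I \<alpha>"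
    and left: "\<And>\<alpha> t. \<alpha> \<in> {0<..1} \<Longrightarrow> (\<And>\<beta>. 0 < \<beta> \<Longrightarrow> \<beta> < \<alpha> \<Longrightarrow> t \<in> I \<beta>) \<Longrightarrow> t \<in> I \<alpha>"
    and zero: "I 0 = closure (\<Union>\<alpha>\<in>{0<..1}. I \<alpha>)"
  shows "\<exists>!w. \<forall>\<alpha>\<in>{0..1}. level w \<alpha> = I \<alpha>"
proof -
  define w where "w t = Sup (insert 0 {\<alpha>\<in>{0<..1}. t \<in> I \<alpha>})" for t
  have bdd: "bdd_above (insert 0 {\<alpha>\<in>{0<..1}. t \<in> I \<alpha>})" for t
    by (intro bdd_aboveI[of _ 1]) auto
  have w0: "0 \<le> w t" for t unfolding w_def by (intro cSup_upper bdd) auto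
  have w1: "w t \<le> 1" for t unfolding w_def by (intro cSup_least) auto
  have key: "\<alpha> \<le> w t \<longleftrightarrow> t \<in> I \<alpha>" if a: "\<alpha> \<in> {0<..1}" for \<alpha> t
  proof
    assume "t \<in> I \<alpha>"
    then show "\<alpha> \<le> w t" unfolding w_def using a by (intro cSup_upper bdd) auto
  next
    assume le: "\<alpha> \<le> w t"
    show "t \<in> I \<alpha>"
    proof (rule left[OF a])
      fix \<beta> assume b: "0 < \<beta>" "\<beta> < \<alpha>"
      then have "\<beta> < Sup (insert 0 {\<alpha>\<in>{0<..1}. t \<in> I \<alpha>})" using le w_def by simp
      then obtain \<gamma> where "\<gamma> \<in> insert 0 {\<alpha>\<in>{0<..1}. t \<in> I \<alpha>}" "\<beta> < \<gamma>"
        using less_cSup_iff[OF _ bdd] by blast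
      then show "t \<in> I \<beta>" using b anti[of \<beta> \<gamma>] by auto
    qed
  qed
  have supp: "{t. w t > 0} = (\<Union>\<alpha>\<in>{0<..1}. I \<alpha>)"
  proof (intro set_eqI iffI)
    fix t assume "t \<in> {t. w t > 0}"
    then show "t \<in> (\<Union>\<alpha>\<in>{0<..1}. I \<alpha>)" using key[of "w t" t] w1[of t] by auto
  next
    fix t assume "t \<in> (\<Union>\<alpha>\<in>{0<..1}. I \<alpha>)"
    then obtain \<alpha> where "\<alpha> \<in> {0<..1}" "t \<in> I \<alpha>" by auto
    then show "t \<in> {t. w t > 0}" using key[of \<alpha> t] by auto
  qed
  have norm: "\<exists>t. w t = 1" using ne[of 1] key[of 1] w1 by (force intro: antisym)
  have fconv: "min (w s) (w t) \<le> w (l * s + (1 - l) * t)" if l: "l \<in> {0..1}" for s t l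
  proof (cases "min (w s) (w t) > 0")
    case False
    then show ?thesis using w0[of "l * s + (1 - l) * t"] by linarith
  next
    case True
    let ?m = "min (w s) (w t)"
    have m: "?m \<in> {0<..1}" using True w1[of s] by auto
    have st: "s \<in> I ?m" "t \<in> I ?m"
      using key[OF m, of s] key[OF m, of t] min.cobounded1 min.cobounded2 by blast+
    have "convex (I ?m)" by (rule conv) (use m in auto)
    from convexD[OF this st, of l "1 - l"] have "l * s + (1 - l) * t \<in> I ?m"
      using l by simp
    then show ?thesis using key[OF m] by blast
  qed
  have usc: "\<forall>\<^sub>F s in at t. w s < y" if "w t < y" for t y
  proof (cases "y > 1")
    case True
    then have "w s < y" for s using w1[of s] by linarith
    then show ?thesis by simp
  next
    case False
    then have y: "y \<in> {0<..1}" using that w0[of t] by auto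
    have "open (- I y)" using comp[of y] y compact_imp_closed by auto
    moreover have "t \<in> - I y" using key[OF y, of t] that by auto
    ultimately have "\<forall>\<^sub>F s in at t. s \<in> - I y"
      unfolding eventually_at_topological by blast
    then show ?thesis by (rule eventually_mono) (use key[OF y] in \<open>auto simp: not_le[symmetric]\<close>)
  qed
  have fnw: "is_fuzzy_number w"
    unfolding is_fuzzy_number_def supp zero[symmetric]
    using w0 w1 norm fconv usc comp[of 0] by auto
  then have mem: "membership (Abs_fuzzy_number w) = w" by (simp add: Abs_fuzzy_number_inverse)
  have lev: "\<forall>\<alpha>\<in>{0..1}. level (Abs_fuzzy_number w) \<alpha> = I \<alpha>"
    using key by (auto simp: level_def mem supp zero)
  show ?thesis
  proof (rule ex1I, rule lev)
    fix v assume "\<forall>\<alpha>\<in>{0..1}. level v \<alpha> = I \<alpha>"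
    then show "v = Abs_fuzzy_number w" using lev by (intro fuzzy_number_level_eqI) auto
  qed
qed

lemma lower_left:
  assumes "\<alpha> \<in> {0<..1}" "0 < e"
  shows "\<exists>\<gamma>. 0 < \<gamma> \<and> \<gamma> < \<alpha> \<and> lower u \<alpha> - e < lower u \<gamma>"
proof (rule ccontr)
  assume n: "\<not> ?thesis"
  have "lower u \<alpha> - e \<in> level u \<alpha>"
  proof (rule level_left[OF assms(1)])
    fix \<beta> assume b: "0 < \<beta>" "\<beta> < \<alpha>"
    then have "lower u \<beta> \<le> lower u \<alpha> - e" using n by (meson not_le)
    moreover have "lower u \<alpha> \<in> level u \<beta>"
      using level_antimono[of \<beta> \<alpha> u] level_interval[of \<alpha> u] b assms by auto
    ultimately show "lower u \<alpha> - e \<in> level u \<beta>"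
      using level_interval[of \<beta> u] b assms by auto
  qed
  then show False using level_interval[of \<alpha> u] assms by auto
qed

lemma upper_left:
  assumes "\<alpha> \<in> {0<..1}" "0 < e"
  shows "\<exists>\<gamma>. 0 < \<gamma> \<and> \<gamma> < \<alpha> \<and> upper u \<gamma> < upper u \<alpha> + e"
proof (rule ccontr)
  assume n: "\<not> ?thesis"
  have "upper u \<alpha> + e \<in> level u \<alpha>"
  proof (rule level_left[OF assms(1)])
    fix \<beta> assume b: "0 < \<beta>" "\<beta> < \<alpha>"
    then have "upper u \<alpha> + e \<le> upper u \<beta>" using n by (meson not_le)
    moreover have "upper u \<alpha> \<in> level u \<beta>"
      using level_antimono[of \<beta> \<alpha> u] level_interval[of \<alpha> u] b assms by auto
    ultimately show "upper u \<alpha> + e \<in> level u \<beta>"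
      using level_interval[of \<beta> u] b assms by auto
  qed
  then show False using level_interval[of \<alpha> u] assms by auto
qed

lemma lower_upper_antimono:
  assumes "0 \<le> \<alpha>" "\<alpha> \<le> \<beta>" "\<beta> \<le> 1"
  shows "lower u \<alpha> \<le> lower u \<beta>" "upper u \<beta> \<le> upper u \<alpha>"
  using level_antimono[OF assms(1,2), of u] level_interval[of \<alpha> u] level_interval[of \<beta> u] assms
  by auto

lemma sum_levels:
  assumes "\<alpha> \<in> {0..1}"
  shows "{lower u \<alpha> + lower v \<alpha>..upper u \<alpha> + upper v \<alpha>}
    = {x + y | x y. x \<in> level u \<alpha> \<and> y \<in> level v \<alpha>}" (is "?L = ?R")
proof
  show "?R \<subseteq> ?L" using level_interval[OF assms] by auto
  show "?L \<subseteq> ?R"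
  proof
    fix t assume t: "t \<in> ?L"
    let ?x = "min (upper u \<alpha>) (t - lower v \<alpha>)"
    have "?x \<in> level u \<alpha>" "t - ?x \<in> level v \<alpha>"
      using t level_interval[OF assms, of u] level_interval[OF assms, of v]
      by (auto simp: min_def)
    then show "t \<in> ?R" by force
  qed
qed

lemma ex1_plus:
  "\<exists>!w. \<forall>\<alpha>\<in>{0..1}. level w \<alpha> = {lower u \<alpha> + lower v \<alpha>..upper u \<alpha> + upper v \<alpha>}"
    (is "\<exists>!w. \<forall>\<alpha>\<in>{0..1}. level w \<alpha> = ?I \<alpha>")
proof (rule fuzzy_number_of_levels)
  show "?I \<alpha> \<noteq> {}" if "\<alpha> \<in> {0..1}" for \<alpha>
    using level_interval(2)[OF that, of u] level_interval(2)[OF that, of v] by simp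
  show anti: "?I \<beta> \<subseteq> ?I \<alpha>" if "0 \<le> \<alpha>" "\<alpha> \<le> \<beta>" "\<beta> \<le> 1" for \<alpha> \<beta>
    using lower_upper_antimono[OF that, of u] lower_upper_antimono[OF that, of v] by auto
  show "t \<in> ?I \<alpha>" if a: "\<alpha> \<in> {0<..1}" and b: "\<And>\<beta>. 0 < \<beta> \<Longrightarrow> \<beta> < \<alpha> \<Longrightarrow> t \<in> ?I \<beta>" for \<alpha> t
  proof -
    have "lower u \<alpha> + lower v \<alpha> \<le> t"
    proof (rule field_le_epsilon)
      fix e :: real assume "0 < e"
      then have e: "e / 2 > 0" by simp
      obtain \<beta> \<gamma> where bc: "0 < \<beta>" "\<beta> < \<alpha>" "lower u \<alpha> - e / 2 < lower u \<beta>"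
        "0 < \<gamma>" "\<gamma> < \<alpha>" "lower v \<alpha> - e / 2 < lower v \<gamma>"
        using lower_left[OF a e] by metis
      let ?m = "max \<beta> \<gamma>"
      have "t \<in> ?I ?m" using b bc by simp
      moreover have "lower u \<beta> \<le> lower u ?m" "lower v \<gamma> \<le> lower v ?m"
        using lower_upper_antimono(1) bc a by auto
      ultimately show "lower u \<alpha> + lower v \<alpha> \<le> t + e" using bc by auto
    qed
    moreover have "t \<le> upper u \<alpha> + upper v \<alpha>"
    proof (rule field_le_epsilon)
      fix e :: real assume "0 < e"
      then have e: "e / 2 > 0" by simp
      obtain \<beta> \<gamma> where bc: "0 < \<beta>" "\<beta> < \<alpha>" "upper u \<beta> < upper u \<alpha> + e / 2"
        "0 < \<gamma>" "\<gamma> < \<alpha>" "upper v \<gamma> < upper v \<alpha> + e / 2"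
        using upper_left[OF a e] by metis
      let ?m = "max \<beta> \<gamma>"
      have "t \<in> ?I ?m" using b bc by simp
      moreover have "upper u ?m \<le> upper u \<beta>" "upper v ?m \<le> upper v \<gamma>"
        using lower_upper_antimono(2) bc a by auto
      ultimately show "t \<le> upper u \<alpha> + upper v \<alpha> + e" using bc by auto
    qed
    ultimately show ?thesis by simp
  qed
  show "?I 0 = closure (\<Union>\<alpha>\<in>{0<..1}. ?I \<alpha>)"
  proof
    show "closure (\<Union>\<alpha>\<in>{0<..1}. ?I \<alpha>) \<subseteq> ?I 0"
    proof (rule closure_minimal)
      show "(\<Union>\<alpha>\<in>{0<..1}. ?I \<alpha>) \<subseteq> ?I 0" using anti[of 0] by (intro UN_least) auto
    qed simp
    show "?I 0 \<subseteq> closure (\<Union>\<alpha>\<in>{0<..1}. ?I \<alpha>)"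
    proof
      fix t assume "t \<in> ?I 0"
      then obtain x y where xy: "t = x + y" "x \<in> level u 0" "y \<in> level v 0"
        using sum_levels[of 0 u v] by auto
      obtain f where f: "\<And>n. f n \<in> (\<Union>\<alpha>\<in>{0<..1}. level u \<alpha>)" "f \<longlonglongrightarrow> x"
        using xy(2) unfolding level_0 closure_sequential by auto
      obtain g where g: "\<And>n. g n \<in> (\<Union>\<alpha>\<in>{0<..1}. level v \<alpha>)" "g \<longlonglongrightarrow> y"
        using xy(3) unfolding level_0 closure_sequential by auto
      have "f n + g n \<in> (\<Union>\<alpha>\<in>{0<..1}. ?I \<alpha>)" for n
      proof -
        obtain \<beta> \<gamma> where bc: "\<beta> \<in> {0<..1}" "f n \<in> level u \<beta>" "\<gamma> \<in> {0<..1}" "g n \<in> level v \<gamma>"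
          using f(1)[of n] g(1)[of n] by blast
        let ?m = "min \<beta> \<gamma>"
        have "f n \<in> level u ?m" "g n \<in> level v ?m" "?m \<in> {0<..1}"
          using bc level_antimono[of ?m \<beta> u] level_antimono[of ?m \<gamma> v] by auto
        then show ?thesis using sum_levels[of ?m u v] by (intro UN_I[of ?m]) auto
      qed
      then show "t \<in> closure (\<Union>\<alpha>\<in>{0<..1}. ?I \<alpha>)"
        unfolding closure_sequential xy(1)
        by (intro exI[of _ "\<lambda>n. f n + g n"]) (auto intro!: tendsto_add f(2) g(2))
    qed
  qed
qed auto

lemma ex1_scale: "\<exists>!w. \<forall>\<alpha>\<in>{0..1}. level w \<alpha> = (\<lambda>t. k * t) ` level u \<alpha>"
proof (rule fuzzy_number_of_levels)
  show "compact ((\<lambda>t. k * t) ` level u \<alpha>)" if "\<alpha> \<in> {0..1}" for \<alpha>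
    using compact_scaling[OF level_compact[OF that], of k u] by simp
  show "convex ((\<lambda>t. k * t) ` level u \<alpha>)" if "\<alpha> \<in> {0..1}" for \<alpha>
    using convex_scaling[OF level_convex[OF that], of k u] by simp
  show "(\<lambda>t. k * t) ` level u \<alpha> \<noteq> {}" if "\<alpha> \<in> {0..1}" for \<alpha>
    using level_nonempty[OF that] by simp
  show "(\<lambda>t. k * t) ` level u \<beta> \<subseteq> (\<lambda>t. k * t) ` level u \<alpha>"
    if "0 \<le> \<alpha>" "\<alpha> \<le> \<beta>" "\<beta> \<le> 1" for \<alpha> \<beta>
    using level_antimono[OF that(1,2)] by (rule image_mono)
  show "t \<in> (\<lambda>t. k * t) ` level u \<alpha>"
    if a: "\<alpha> \<in> {0<..1}" and b: "\<And>\<beta>. 0 < \<beta> \<Longrightarrow> \<beta> < \<alpha> \<Longrightarrow> t \<in> (\<lambda>t. k * t) ` level u \<beta>" for \<alpha> t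
  proof (cases "k = 0")
    case True
    then have "t = 0" using b[of "\<alpha> / 2"] a by auto
    then show ?thesis using True level_nonempty[of \<alpha> u] a by auto
  next
    case False
    have "t / k \<in> level u \<alpha>"
    proof (rule level_left[OF a])
      fix \<beta> assume "0 < \<beta>" "\<beta> < \<alpha>"
      from b[OF this] show "t / k \<in> level u \<beta>" using False by auto
    qed
    then show ?thesis using False by (intro image_eqI[of _ _ "t / k"]) auto
  qed
  show "(\<lambda>t. k * t) ` level u 0 = closure (\<Union>\<alpha>\<in>{0<..1}. (\<lambda>t. k * t) ` level u \<alpha>)"
    unfolding level_0 image_UN[symmetric]
    using closure_scaleR[of k "\<Union>\<alpha>\<in>{0<..1}. level u \<alpha>"] by simp
qed

text \<open>Only the syntactic class of scaling is instantiated: fuzzy numbers are not a vector space,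
  as neither additive inverses nor the law (a + b) u = a u + b u exist in general. The zero is the
  crisp number 0; it serves as the empty sum.\<close>

instantiation fuzzy_number :: "{zero, plus, scaleR}"
begin

definition zero_fuzzy_number :: fuzzy_number where
  "0 = Abs_fuzzy_number (indicator {0})"

definition plus_fuzzy_number :: "fuzzy_number \<Rightarrow> fuzzy_number \<Rightarrow> fuzzy_number" where
  "u + v = (THE w. \<forall>\<alpha>\<in>{0..1}.
     level w \<alpha> = {lower u \<alpha> + lower v \<alpha>..upper u \<alpha> + upper v \<alpha>})"

definition scaleR_fuzzy_number :: "real \<Rightarrow> fuzzy_number \<Rightarrow> fuzzy_number" where
  "k *\<^sub>R u = (THE w. \<forall>\<alpha>\<in>{0..1}. level w \<alpha> = (\<lambda>t. k * t) ` level u \<alpha>)"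

instance ..

end

lemma level_plus:
  "\<alpha> \<in> {0..1} \<Longrightarrow> level (u + v) \<alpha> = {lower u \<alpha> + lower v \<alpha>..upper u \<alpha> + upper v \<alpha>}"
  using theI'[OF ex1_plus[of u v]] by (simp add: plus_fuzzy_number_def)

lemma level_scaleR:
  "\<alpha> \<in> {0..1} \<Longrightarrow> level (k *\<^sub>R u) \<alpha> = (\<lambda>t. k * t) ` level u \<alpha>"
  using theI'[OF ex1_scale[of k u]] by (simp add: scaleR_fuzzy_number_def)

lemma lower_upper_plus:
  assumes "\<alpha> \<in> {0..1}"
  shows "lower (u + v) \<alpha> = lower u \<alpha> + lower v \<alpha>" "upper (u + v) \<alpha> = upper u \<alpha> + upper v \<alpha>"
  using level_plus[OF assms, of u v] level_interval(2)[OF assms, of u]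
    level_interval(2)[OF assms, of v]
  by (auto simp: lower_def[of "u + v"] upper_def[of "u + v"])

lemma membership_0: "membership 0 = indicator {0}"
proof -
  have s: "{t::real. indicator {0} t > (0::real)} = {0}" by (auto simp: indicator_def)
  have "\<forall>\<^sub>F s in at t. indicator {0} s < y" if "indicator {0} t < y" for t y :: real
  proof -
    have "\<forall>\<^sub>F s in at t. s \<noteq> 0" by (rule eventually_neq_at_within)
    moreover have "0 < y" using that by (rule le_less_trans[rotated]) simp
    ultimately show ?thesis
      by (auto elim!: eventually_mono)
  qed
  then have "is_fuzzy_number (indicator {0})"
    unfolding is_fuzzy_number_def s by (auto simp: indicator_def)
  then show ?thesis by (simp add: zero_fuzzy_number_def Abs_fuzzy_number_inverse)
qed

lemma level_zero: "\<alpha> \<in> {0..1} \<Longrightarrow> level 0 \<alpha> = {0}"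
proof -
  have "{t::real. indicator {0} t > (0::real)} = {0}" by (auto simp: indicator_def)
  then show "\<alpha> \<in> {0..1} \<Longrightarrow> level 0 \<alpha> = {0}"
    by (auto simp: level_def membership_0 indicator_def split: if_splits)
qed

instance fuzzy_number :: comm_monoid_add
proof
  fix u v w :: fuzzy_number
  show "u + v + w = u + (v + w)" by (rule fuzzy_number_eqI) (simp_all add: lower_upper_plus)
  show "u + v = v + u" by (rule fuzzy_number_eqI) (simp_all add: lower_upper_plus)
  show "0 + u = u"
    by (rule fuzzy_number_eqI)
      (simp_all add: lower_upper_plus lower_def[of 0] upper_def[of 0] level_zero)
qed

lemma bdd_above_dist:
  "bdd_above ((\<lambda>\<alpha>. max \<bar>lower u \<alpha> - lower v \<alpha>\<bar> \<bar>upper u \<alpha> - upper v \<alpha>\<bar>) ` {0..1})"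
proof (rule bdd_aboveI2)
  fix \<alpha> :: real assume a: "\<alpha> \<in> {0..1}"
  have *: "\<bar>lower w \<alpha>\<bar> \<le> \<bar>lower w 0\<bar> + \<bar>upper w 0\<bar>" "\<bar>upper w \<alpha>\<bar> \<le> \<bar>lower w 0\<bar> + \<bar>upper w 0\<bar>" for w
    using lower_upper_antimono[of 0 \<alpha> w] level_interval(2)[OF a, of w] a by auto
  show "max \<bar>lower u \<alpha> - lower v \<alpha>\<bar> \<bar>upper u \<alpha> - upper v \<alpha>\<bar>
      \<le> (\<bar>lower u 0\<bar> + \<bar>upper u 0\<bar>) + (\<bar>lower v 0\<bar> + \<bar>upper v 0\<bar>)"
    using *[of u] *[of v]
    by (intro max.boundedI order.trans[OF abs_triangle_ineq4] add_mono)
qed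

instantiation fuzzy_number :: metric_space
begin

definition dist_fuzzy_number :: "fuzzy_number \<Rightarrow> fuzzy_number \<Rightarrow> real" where
  "dist u v =
     (SUP \<alpha>\<in>{0..1}. max \<bar>lower u \<alpha> - lower v \<alpha>\<bar> \<bar>upper u \<alpha> - upper v \<alpha>\<bar>)"

definition uniformity_fuzzy_number :: "(fuzzy_number \<times> fuzzy_number) filter" where
  "uniformity = (INF e\<in>{0<..}. principal {(u, v). dist (u :: fuzzy_number) v < e})"

definition open_fuzzy_number :: "fuzzy_number set \<Rightarrow> bool" where
  "open (U :: fuzzy_number set) \<longleftrightarrow> (\<forall>u\<in>U. eventually (\<lambda>(u', v). u' = u \<longrightarrow> v \<in> U) uniformity)"

instance
proof
  have ub: "max \<bar>lower u \<alpha> - lower v \<alpha>\<bar> \<bar>upper u \<alpha> - upper v \<alpha>\<bar> \<le> dist u v"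
    if "\<alpha> \<in> {0..1}" for u v :: fuzzy_number and \<alpha>
    unfolding dist_fuzzy_number_def by (rule cSUP_upper[OF that bdd_above_dist])
  fix u v w :: fuzzy_number
  show "uniformity = (INF e\<in>{0<..}. principal {(u, v). dist (u :: fuzzy_number) v < e})"
    by (rule uniformity_fuzzy_number_def)
  show "open U \<longleftrightarrow> (\<forall>u\<in>U. eventually (\<lambda>(u', v). u' = u \<longrightarrow> v \<in> U) uniformity)"
    for U :: "fuzzy_number set"
    by (rule open_fuzzy_number_def)
  show "dist u v = 0 \<longleftrightarrow> u = v"
  proof
    assume d: "dist u v = 0"
    have "lower u \<alpha> = lower v \<alpha> \<and> upper u \<alpha> = upper v \<alpha>" if "\<alpha> \<in> {0..1}" for \<alpha>
      using ub[OF that, of u v] d by auto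
    then show "u = v" by (intro fuzzy_number_eqI) auto
  qed (simp add: dist_fuzzy_number_def)
  show "dist u v \<le> dist u w + dist v w"
    unfolding dist_fuzzy_number_def[of u v]
  proof (rule cSUP_least)
    fix \<alpha> :: real assume a: "\<alpha> \<in> {0..1}"
    have "\<bar>lower u \<alpha> - lower w \<alpha>\<bar> \<le> dist u w" "\<bar>upper u \<alpha> - upper w \<alpha>\<bar> \<le> dist u w"
      "\<bar>lower v \<alpha> - lower w \<alpha>\<bar> \<le> dist v w" "\<bar>upper v \<alpha> - upper w \<alpha>\<bar> \<le> dist v w"
      using ub[OF a, of u w] ub[OF a, of v w] by simp_all
    then show "max \<bar>lower u \<alpha> - lower v \<alpha>\<bar> \<bar>upper u \<alpha> - upper v \<alpha>\<bar> \<le> dist u w + dist v w"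
      by (intro max.boundedI; linarith)
  qed simp
qed

end

end

theory Submission
  imports Defs
begin

text \<open>
  Write \<open>S i\<close> for the partial sums of the fuzzy series and \<open>U\<close> for its sum. Collecting the terms of
  the Cauchy product by the index of \<open>x\<close> instead of by total degree, its \<open>n\<close>-th partial sum becomes
  \<open>\<Sum>j\<le>n. x j *\<^sub>R S (n - j)\<close>, a combination of the \<open>S i\<close> with non-negative weights
  (\<open>sum_Cauchy_product_eq\<close>). It is compared with \<open>(\<Sum>j\<le>n. x j) *\<^sub>R U\<close>. As the metric is subadditive
  with respect to addition and homogeneous with respect to scaling, their distance is at most
  \<open>\<Sum>j\<le>n. x j * dist (S (n - j)) U\<close>, and the convolution of a summable sequence with a null sequence
  is a null sequence (\<open>convolution_tendsto_zero\<close>). Finally, \<open>(\<Sum>j\<le>n. x j) *\<^sub>R U\<close> tends to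
  \<open>(\<Sum>j. x j) *\<^sub>R U\<close>, because scaling a fixed fuzzy number by non-negative reals is Lipschitz.

  This is the proof of Mertens' theorem. Non-negativity of \<open>x\<close> does two things: it turns convergence
  of \<open>\<Sum>n. x n\<close> into absolute convergence, and it makes available the law
  \<open>(a + b) *\<^sub>R u = a *\<^sub>R u + b *\<^sub>R u\<close>, which fails for every \<open>u\<close> that is not crisp when \<open>a\<close> and \<open>b\<close>
  have opposite signs: the lengths of the levels of the right-hand side are then proportional to
  \<open>\<bar>a\<bar> + \<bar>b\<bar>\<close>, those of the left-hand side only to \<open>\<bar>a + b\<bar>\<close>.
\<close>

section \<open>Scaling by non-negative reals\<close>

lemma lower_upper_zero:
  assumes "\<alpha> \<in> {0..1}"
  shows "lower 0 \<alpha> = 0" "upper 0 \<alpha> = 0"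
  using level_zero[OF assms] by (simp_all add: lower_def upper_def)

lemma lower_upper_scaleR:
  assumes "0 \<le> k" "\<alpha> \<in> {0..1}"
  shows "lower (k *\<^sub>R u) \<alpha> = k * lower u \<alpha>" "upper (k *\<^sub>R u) \<alpha> = k * upper u \<alpha>"
proof -
  have "level (k *\<^sub>R u) \<alpha> = (\<lambda>t. k * t) ` {lower u \<alpha>..upper u \<alpha>}"
    using level_scaleR[OF assms(2)] level_interval(1)[OF assms(2)] by simp
  also have "\<dots> = {k * lower u \<alpha>..k * upper u \<alpha>}"
    using assms(1) level_interval(2)[OF assms(2), of u] by (simp add: image_mult_atLeastAtMost_if)
  finally show "lower (k *\<^sub>R u) \<alpha> = k * lower u \<alpha>" "upper (k *\<^sub>R u) \<alpha> = k * upper u \<alpha>"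
    using mult_left_mono[OF level_interval(2)[OF assms(2), of u] assms(1)]
    by (simp_all add: lower_def[of "k *\<^sub>R u"] upper_def[of "k *\<^sub>R u"])
qed

lemma fuzzy_scaleR_add_right:
  fixes u v :: fuzzy_number
  assumes "0 \<le> k"
  shows "k *\<^sub>R (u + v) = k *\<^sub>R u + k *\<^sub>R v"
  using assms
  by (intro fuzzy_number_eqI) (simp_all add: lower_upper_scaleR lower_upper_plus distrib_left)

lemma fuzzy_scaleR_add_left:
  fixes u :: fuzzy_number
  assumes "0 \<le> a" "0 \<le> b"
  shows "(a + b) *\<^sub>R u = a *\<^sub>R u + b *\<^sub>R u"
  using assms
  by (intro fuzzy_number_eqI) (simp_all add: lower_upper_scaleR lower_upper_plus distrib_right)

lemma fuzzy_scaleR_zero_right: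
  assumes "0 \<le> k"
  shows "k *\<^sub>R (0 :: fuzzy_number) = 0"
  using assms by (intro fuzzy_number_eqI) (simp_all add: lower_upper_scaleR lower_upper_zero)

lemma fuzzy_scaleR_zero_left: "0 *\<^sub>R (u :: fuzzy_number) = 0"
  by (intro fuzzy_number_eqI) (simp_all add: lower_upper_scaleR lower_upper_zero)

lemma fuzzy_scaleR_sum_right:
  fixes u :: "'i \<Rightarrow> fuzzy_number"
  assumes "0 \<le> k"
  shows "k *\<^sub>R (\<Sum>i\<in>A. u i) = (\<Sum>i\<in>A. k *\<^sub>R u i)"
  by (induction A rule: infinite_finite_induct)
    (simp_all add: assms fuzzy_scaleR_zero_right fuzzy_scaleR_add_right)

lemma fuzzy_scaleR_sum_left:
  fixes u :: fuzzy_number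
  assumes "\<And>i. i \<in> A \<Longrightarrow> 0 \<le> x i"
  shows "(\<Sum>i\<in>A. x i) *\<^sub>R u = (\<Sum>i\<in>A. x i *\<^sub>R u)"
  using assms
  by (induction A rule: infinite_finite_induct)
    (simp_all add: fuzzy_scaleR_zero_left fuzzy_scaleR_add_left sum_nonneg)

section \<open>The metric and the algebraic operations\<close>

lemma lower_upper_dist_le:
  assumes "\<alpha> \<in> {0..1}"
  shows "\<bar>lower u \<alpha> - lower v \<alpha>\<bar> \<le> dist u v" "\<bar>upper u \<alpha> - upper v \<alpha>\<bar> \<le> dist u v"
  using cSUP_upper[OF assms bdd_above_dist, of u v] by (simp_all add: dist_fuzzy_number_def)

lemma fuzzy_dist_leI:
  assumes "\<And>\<alpha>. \<alpha> \<in> {0..1} \<Longrightarrow> \<bar>lower u \<alpha> - lower v \<alpha>\<bar> \<le> d"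
    and "\<And>\<alpha>. \<alpha> \<in> {0..1} \<Longrightarrow> \<bar>upper u \<alpha> - upper v \<alpha>\<bar> \<le> d"
  shows "dist u v \<le> d"
  unfolding dist_fuzzy_number_def by (rule cSUP_least) (use assms in auto)

lemma fuzzy_dist_add_le:
  fixes u u' v v' :: fuzzy_number
  shows "dist (u + u') (v + v') \<le> dist u v + dist u' v'"
proof (rule fuzzy_dist_leI)
  fix \<alpha> :: real assume a: "\<alpha> \<in> {0..1}"
  show "\<bar>lower (u + u') \<alpha> - lower (v + v') \<alpha>\<bar> \<le> dist u v + dist u' v'"
    using lower_upper_dist_le(1)[OF a, of u v] lower_upper_dist_le(1)[OF a, of u' v']
    by (simp add: lower_upper_plus[OF a])
  show "\<bar>upper (u + u') \<alpha> - upper (v + v') \<alpha>\<bar> \<le> dist u v + dist u' v'"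
    using lower_upper_dist_le(2)[OF a, of u v] lower_upper_dist_le(2)[OF a, of u' v']
    by (simp add: lower_upper_plus[OF a])
qed

lemma fuzzy_dist_sum_le:
  fixes u v :: "'i \<Rightarrow> fuzzy_number"
  shows "dist (\<Sum>i\<in>A. u i) (\<Sum>i\<in>A. v i) \<le> (\<Sum>i\<in>A. dist (u i) (v i))"
  by (induction A rule: infinite_finite_induct)
    (auto intro: order.trans[OF fuzzy_dist_add_le])

lemma fuzzy_dist_scaleR_le:
  fixes u v :: fuzzy_number
  assumes "0 \<le> k"
  shows "dist (k *\<^sub>R u) (k *\<^sub>R v) \<le> k * dist u v"
proof (rule fuzzy_dist_leI)
  fix \<alpha> :: real assume a: "\<alpha> \<in> {0..1}"
  show "\<bar>lower (k *\<^sub>R u) \<alpha> - lower (k *\<^sub>R v) \<alpha>\<bar> \<le> k * dist u v"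
    using mult_left_mono[OF lower_upper_dist_le(1)[OF a, of u v] assms] assms
    by (simp add: lower_upper_scaleR[OF assms a] abs_mult flip: right_diff_distrib)
  show "\<bar>upper (k *\<^sub>R u) \<alpha> - upper (k *\<^sub>R v) \<alpha>\<bar> \<le> k * dist u v"
    using mult_left_mono[OF lower_upper_dist_le(2)[OF a, of u v] assms] assms
    by (simp add: lower_upper_scaleR[OF assms a] abs_mult flip: right_diff_distrib)
qed

text \<open>The distance to the crisp number \<open>0\<close> bounds all end points of \<open>u\<close>, and so plays the part of
  a norm.\<close>

lemma fuzzy_dist_scaleR_Lipschitz:
  fixes u :: fuzzy_number
  assumes "0 \<le> a" "0 \<le> b"
  shows "dist (a *\<^sub>R u) (b *\<^sub>R u) \<le> \<bar>a - b\<bar> * dist u 0"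
proof (rule fuzzy_dist_leI)
  fix \<alpha> :: real assume i: "\<alpha> \<in> {0..1}"
  show "\<bar>lower (a *\<^sub>R u) \<alpha> - lower (b *\<^sub>R u) \<alpha>\<bar> \<le> \<bar>a - b\<bar> * dist u 0"
    using mult_left_mono[OF lower_upper_dist_le(1)[OF i, of u 0], of "\<bar>a - b\<bar>"]
    by (simp add: lower_upper_scaleR[OF _ i] assms lower_upper_zero[OF i] abs_mult
        flip: left_diff_distrib)
  show "\<bar>upper (a *\<^sub>R u) \<alpha> - upper (b *\<^sub>R u) \<alpha>\<bar> \<le> \<bar>a - b\<bar> * dist u 0"
    using mult_left_mono[OF lower_upper_dist_le(2)[OF i, of u 0], of "\<bar>a - b\<bar>"]
    by (simp add: lower_upper_scaleR[OF _ i] assms lower_upper_zero[OF i] abs_mult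
        flip: left_diff_distrib)
qed

lemma tendsto_fuzzy_scaleR_left:
  fixes u :: fuzzy_number
  assumes "(a \<longlongrightarrow> b) F" "\<And>n. 0 \<le> a n" "0 \<le> b"
  shows "((\<lambda>n. a n *\<^sub>R u) \<longlongrightarrow> b *\<^sub>R u) F"
proof (rule metric_tendsto_imp_tendsto)
  have "((\<lambda>n. \<bar>a n - b\<bar> * dist u 0) \<longlongrightarrow> \<bar>b - b\<bar> * dist u 0) F"
    by (intro tendsto_intros assms)
  then show "((\<lambda>n. \<bar>a n - b\<bar> * dist u 0) \<longlongrightarrow> 0) F" by simp
  show "\<forall>\<^sub>F n in F. dist (a n *\<^sub>R u) (b *\<^sub>R u) \<le> dist (\<bar>a n - b\<bar> * dist u 0) 0"
    using fuzzy_dist_scaleR_Lipschitz[OF assms(2,3)] by (simp add: abs_mult)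
qed

section \<open>Convolutions\<close>

lemma sum_triangle_swap:
  fixes g :: "nat \<Rightarrow> nat \<Rightarrow> 'a::comm_monoid_add"
  shows "(\<Sum>m\<le>n. \<Sum>k\<le>m. g k (m - k)) = (\<Sum>j\<le>n. \<Sum>k\<le>n - j. g k j)"
proof -
  have "(\<Sum>m\<le>n. \<Sum>k\<le>m. g k (m - k)) = (\<Sum>(k, j)\<in>{(k, j). k + j \<le> n}. g k j)"
    by (rule sum.triangle_reindex_eq[symmetric])
  also have "\<dots> = (\<Sum>(j, k)\<in>(SIGMA j:{..n}. {..n - j}). g k j)"
    by (rule sum.reindex_bij_witness[of _ prod.swap prod.swap]) auto
  also have "\<dots> = (\<Sum>j\<le>n. \<Sum>k\<le>n - j. g k j)"
    by (rule sum.Sigma[symmetric]) auto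
  finally show ?thesis .
qed

lemma sum_Cauchy_product_eq:
  fixes u :: "nat \<Rightarrow> fuzzy_number"
  assumes "\<And>n. 0 \<le> x n"
  shows "(\<Sum>m\<le>n. \<Sum>k\<le>m. x (m - k) *\<^sub>R u k) = (\<Sum>j\<le>n. x j *\<^sub>R (\<Sum>k\<le>n - j. u k))"
  using sum_triangle_swap[of "\<lambda>k j. x j *\<^sub>R u k" n] by (simp add: fuzzy_scaleR_sum_right assms)

text \<open>Each single term \<open>x j * d (n - j)\<close> tends to \<open>0\<close> as \<open>n\<close> grows, and it is dominated by a
  constant multiple of \<open>\<bar>x j\<bar>\<close>; so Tannery's theorem applies to the terms extended by \<open>0\<close> beyond
  \<open>j = n\<close>.\<close>

lemma convolution_tendsto_zero:
  fixes x d :: "nat \<Rightarrow> real"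
  assumes "summable (\<lambda>n. \<bar>x n\<bar>)" "d \<longlonglongrightarrow> 0"
  shows "(\<lambda>n. \<Sum>j\<le>n. x j * d (n - j)) \<longlonglongrightarrow> 0"
proof -
  define a where "a j n = (if j \<le> n then x j * d (n - j) else 0)" for j n
  obtain B where B: "\<And>n. norm (d n) \<le> B"
    using convergent_imp_Bseq[OF convergentI[OF assms(2)]] by (auto simp: Bseq_def)
  have bound: "norm (a j n) \<le> \<bar>x j\<bar> * B" for j n
    using B[of "n - j"] by (simp add: a_def abs_mult mult_left_mono)
  have lim: "(\<lambda>n. a j n) \<longlonglongrightarrow> 0" for j
  proof -
    have "(\<lambda>n. x j * d (n - j)) \<longlonglongrightarrow> x j * 0"
      using assms(2) by (intro tendsto_mult_left) (rule LIMSEQ_offset[of _ j], simp)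
    moreover have "\<forall>\<^sub>F n in sequentially. x j * d (n - j) = a j n"
      using eventually_ge_at_top[of j] by eventually_elim (simp add: a_def)
    ultimately show ?thesis by (simp add: Lim_transform_eventually)
  qed
  have "(\<lambda>n. \<Sum>j. a j n) \<longlonglongrightarrow> (\<Sum>j. 0)"
  proof (rule tannerys_theorem[THEN conjunct2, THEN conjunct2, OF lim])
    show "\<forall>\<^sub>F (j, n) in sequentially \<times>\<^sub>F sequentially. norm (a j n) \<le> \<bar>x j\<bar> * B"
      using bound by (auto intro: always_eventually)
    show "summable (\<lambda>j. \<bar>x j\<bar> * B)" by (rule summable_mult2[OF assms(1)])
  qed simp
  moreover have "(\<Sum>j. a j n) = (\<Sum>j\<le>n. x j * d (n - j))" for n
    by (subst suminf_finite[of "{..n}"]) (auto simp: a_def)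
  ultimately show ?thesis by simp
qed

section \<open>The Cauchy product of a real series and a series of fuzzy numbers\<close>

theorem theorem3p2:
  fixes u :: "nat \<Rightarrow> fuzzy_number" and x :: "nat \<Rightarrow> real"
  assumes "summable u"
    and "summable x"
    and "\<And>n. x n \<ge> 0"
  shows "(\<lambda>n. \<Sum>k=0..n. x (n - k) *\<^sub>R u k) sums ((\<Sum>n. x n) *\<^sub>R (\<Sum>n. u n))"
proof -
  define U where "U = (\<Sum>n. u n)"
  define P where "P n = (\<Sum>j\<le>n. x j *\<^sub>R (\<Sum>k\<le>n - j. u k))" for n
  define Q where "Q n = (\<Sum>j\<le>n. x j) *\<^sub>R U" for n
  define d where "d n = dist (\<Sum>k\<le>n. u k) U" for n
  have "d \<longlonglongrightarrow> 0"
    using summable_LIMSEQ'[OF assms(1)]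
    unfolding d_def U_def by (rule tendsto_dist_iff[THEN iffD1])
  moreover have "summable (\<lambda>n. \<bar>x n\<bar>)" using assms(2,3) by simp
  ultimately have null: "(\<lambda>n. \<Sum>j\<le>n. x j * d (n - j)) \<longlonglongrightarrow> 0"
    by (intro convolution_tendsto_zero)
  have "dist (P n) (Q n) \<le> (\<Sum>j\<le>n. x j * d (n - j))" for n
  proof -
    have "dist (P n) (Q n) \<le> (\<Sum>j\<le>n. dist (x j *\<^sub>R (\<Sum>k\<le>n - j. u k)) (x j *\<^sub>R U))"
      unfolding P_def Q_def fuzzy_scaleR_sum_left[OF assms(3)] by (rule fuzzy_dist_sum_le)
    also have "\<dots> \<le> (\<Sum>j\<le>n. x j * d (n - j))"
      unfolding d_def by (intro sum_mono fuzzy_dist_scaleR_le assms(3))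
    finally show ?thesis .
  qed
  then have PQ: "(\<lambda>n. dist (P n) (Q n)) \<longlonglongrightarrow> 0"
    by (intro tendsto_sandwich[OF _ _ tendsto_const null]) auto
  have "Q \<longlonglongrightarrow> (\<Sum>n. x n) *\<^sub>R U"
    unfolding Q_def using assms(2,3)
    by (intro tendsto_fuzzy_scaleR_left summable_LIMSEQ' sum_nonneg suminf_nonneg) auto
  then have "(\<lambda>n. dist (Q n) ((\<Sum>n. x n) *\<^sub>R U)) \<longlonglongrightarrow> 0"
    by (rule tendsto_dist_iff[THEN iffD1])
  then have "(\<lambda>n. dist (P n) (Q n) + dist (Q n) ((\<Sum>n. x n) *\<^sub>R U)) \<longlonglongrightarrow> 0"
    by (rule tendsto_add_zero[OF PQ])
  then have "(\<lambda>n. dist (P n) ((\<Sum>n. x n) *\<^sub>R U)) \<longlonglongrightarrow> 0"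
    by (rule tendsto_sandwich[OF _ _ tendsto_const, rotated 2]) (auto intro: always_eventually dist_triangle)
  then have "P \<longlonglongrightarrow> (\<Sum>n. x n) *\<^sub>R U" by (rule tendsto_dist_iff[THEN iffD2])
  moreover have "P = (\<lambda>n. \<Sum>m\<le>n. \<Sum>k=0..m. x (m - k) *\<^sub>R u k)"
    unfolding P_def atLeast0AtMost by (intro ext sum_Cauchy_product_eq[symmetric] assms(3))
  ultimately show ?thesis unfolding sums_def_le U_def by metis
qed

end
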